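(* Let $m$ be a positive integer and $k$ a nonnegative integer. As formal power series in $x$, $$\sum_{n=0}^{\infty}\bigl|L_k(\mathcal{S}^m_n)\bigr|\frac{x^n}{n!}=\frac{1}{k!}\left(\frac{x}{1-mx}\right)^{k},\qquad \sum_{n=0}^{\infty}\bigl|L(\mathcal{S}^m_n)\bigr|\frac{x^n}{n!}=\exp\left(\frac{x}{1-mx}\right).$$
   Context: For $m\ge 1$, the extended Shi arrangement is $\mathcal{S}^m_n=\{\{x_i-x_j=a\}:1\le i<j\le n,\ a\in\mathbb{Z},\ 1-m\le a\le m\}$ in $\mathbb{R}^n$ (for $n=0$ it is the empty arrangement in $\mathbb{R}^0$). A flat of an arrangement $\mathcal{A}$ is a nonempty intersection of hyperplanes of $\mathcal{A}$ (including the ambient space as the empty intersection); $L(\mathcal{A})$ is the set of flats and $L_k(\mathcal{A})$ the set of flats of dimension $k$. *)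

theory Defs
  imports
    "HOL-Analysis.Finite_Function_Topology"
    "HOL-Computational_Algebra.Formal_Power_Series"
begin

text \<open>Since \<open>n\<close> varies inside the statement, the spaces \<open>\<real>\<^sup>n\<close> are realised as the subspaces
  of the real vector space of finitely supported functions \<open>nat \<Rightarrow>\<^sub>0 real\<close> consisting of
  the vectors supported on the coordinates \<open>1, \<dots>, n\<close>.\<close>

definition coord_space :: "nat \<Rightarrow> (nat \<Rightarrow>\<^sub>0 real) set"
  where "coord_space n = {x. Poly_Mapping.keys x \<subseteq> {1..n}}"

definition shi_arrangement :: "nat \<Rightarrow> nat \<Rightarrow> (nat \<Rightarrow>\<^sub>0 real) set set"
  where "shi_arrangement m n =
    {{x \<in> coord_space n. Poly_Mapping.lookup x i - Poly_Mapping.lookup x j = of_int a} | i j a.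
       1 \<le> i \<and> i < j \<and> j \<le> n \<and> 1 - int m \<le> a \<and> a \<le> int m}"

text \<open>The ambient space \<open>V\<close> is a parameter, because it is the value of the empty intersection.\<close>

definition flats :: "'a set \<Rightarrow> 'a set set \<Rightarrow> 'a set set"
  where "flats V \<A> = {X. X \<noteq> {} \<and> (\<exists>\<B>\<subseteq>\<A>. X = V \<inter> \<Inter>\<B>)}"

text \<open>The dimension of a nonempty affine subspace is the dimension of its direction space.
  The library's \<open>aff_dim\<close> is restricted to the class \<open>euclidean_space\<close>.\<close>

definition affine_dim :: "'a::real_vector set \<Rightarrow> nat"
  where "affine_dim X = dim {x - y | x y. x \<in> X \<and> y \<in> X}"

definition flats_of_dim :: "nat \<Rightarrow> 'a::real_vector set \<Rightarrow> 'a set set \<Rightarrow> 'a set set"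
  where "flats_of_dim k V \<A> = {X \<in> flats V \<A>. affine_dim X = k}"

lemma finite_shi_arrangement: "finite (shi_arrangement m n)"
proof -
  have "shi_arrangement m n \<subseteq>
    (\<lambda>(i, j, a). {x \<in> coord_space n. Poly_Mapping.lookup x i - Poly_Mapping.lookup x j = of_int a})
      ` ({1..n} \<times> {1..n} \<times> {1 - int m..int m})"
    unfolding shi_arrangement_def by force
  then show ?thesis
    by (rule finite_subset) auto
qed

lemma finite_flats: "finite \<A> \<Longrightarrow> finite (flats V \<A>)"
proof -
  assume "finite \<A>"
  moreover have "flats V \<A> \<subseteq> (\<lambda>\<B>. V \<inter> \<Inter>\<B>) ` Pow \<A>"
    unfolding flats_def by auto
  ultimately show ?thesis
    by (meson finite_Pow_iff finite_imageI finite_subset)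
qed

end

theory Submission
  imports Defs
begin

text \<open>
  A flat of the extended Shi arrangement is determined by the pairs of coordinates whose difference
  is constant on it, together with these constant differences.  Being in such a pair is an
  equivalence relation on \<open>{1..n}\<close>, so a flat is a partition of the coordinates into blocks where
  each block carries a function \<open>f\<close>, unique up to translation, prescribing the differences
  \<open>x\<^sub>p - x\<^sub>q = f p - f q\<close>.  The differences are integers, and \<open>f\<close> is normalised to have minimum \<open>0\<close>;
  the functions that occur are those for which the block is connected by the hyperplanes
  \<open>x\<^sub>i - x\<^sub>j = a\<close> satisfied by \<open>f\<close>.  The dimension of the flat is the number of blocks, since
  its direction space has the indicator vectors of the blocks as a basis.  This correspondence is
  \<open>bij_betw_flat_of\<close>.

  It remains to count the functions on a block of size \<open>b\<close> (\<open>card_heights\<close>).  Sort the vertices by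
  value, and vertices of equal value by index.  With this tie-breaking rule, an edge between two
  vertices forces an edge between any two consecutive vertices that lie between them
  (\<open>reach_shrink_left\<close>, \<open>reach_shrink_right\<close>), so connectedness only concerns consecutive vertices.
  For consecutive vertices \<open>p, q\<close> the difference \<open>f q - f p\<close> ranges over \<open>0, \<dots>, m - 1\<close> if \<open>p < q\<close>
  and over \<open>1, \<dots>, m\<close> if \<open>q < p\<close>: there are \<open>m\<close> choices in either case.  Hence there are
  \<open>b! m\<^bsup>b-1\<^esup>\<close> functions, and their exponential generating function is \<open>x / (1 - m x)\<close>.

  The theorem is then the exponential formula (\<open>card_decorated_partitions\<close>): if the structures on a
  single block have exponential generating function \<open>C\<close>, the partitions into \<open>k\<close> blocks
  with a structure on each block have \<open>C\<^sup>k / k!\<close>.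
  Summing over \<open>k\<close> gives \<open>exp \<circ> C\<close>.
\<close>

section \<open>Sorting the vertices of a block\<close>

definition before :: "(nat \<Rightarrow> int) \<Rightarrow> nat \<Rightarrow> nat \<Rightarrow> bool"
  where "before f p q \<longleftrightarrow> f p < f q \<or> f p = f q \<and> p < q"

lemma before_irrefl: "\<not> before f p p"
  by (simp add: before_def)

lemma before_trans: "before f p q \<Longrightarrow> before f q r \<Longrightarrow> before f p r"
  by (auto simp: before_def)

lemma before_linear: "before f p q \<or> p = q \<or> before f q p"
  by (auto simp: before_def)

lemma before_cong: "f p = g p \<Longrightarrow> f q = g q \<Longrightarrow> before f p q \<longleftrightarrow> before g p q"
  by (simp add: before_def)

text \<open>For \<open>p\<close> preceding \<open>q\<close>, the bound says exactly that some hyperplane of the arrangement contains the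
  points with \<open>x\<^sub>p - x\<^sub>q = f p - f q\<close>; see \<open>reach_iff_shi_bounds\<close>.  The two cases
  come from the asymmetry of the interval \<open>[1 - m, m]\<close>.\<close>

definition reach :: "nat \<Rightarrow> (nat \<Rightarrow> int) \<Rightarrow> nat \<Rightarrow> nat \<Rightarrow> bool"
  where "reach m f p q \<longleftrightarrow> before f p q \<and> f q - f p \<le> (if p < q then int m - 1 else int m)"

lemma reach_cong: "f p = g p \<Longrightarrow> f q = g q \<Longrightarrow> reach m f p q \<longleftrightarrow> reach m g p q"
  by (simp add: reach_def before_def)

text \<open>Shrinking an edge at either end leaves an edge.  This is where the order on vertices of equal
  value matters: shrinking could only fail by turning an admissible gap of exactly \<open>m\<close> from a larger to
  a smaller index into a gap of \<open>m\<close> from a smaller to a larger index.  The values at the moved end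
  would then be equal, so its index moves in the direction that tie-breaking prescribes, which makes
  such a change of direction impossible.\<close>

lemma reach_shrink_right:
  assumes "reach m f r t" "before f r q" "before f q t"
  shows "reach m f r q"
  using assms by (auto simp: reach_def before_def split: if_splits)

lemma reach_shrink_left:
  assumes "reach m f r q" "before f r p" "before f p q"
  shows "reach m f p q"
  using assms by (auto simp: reach_def before_def split: if_splits)

lemma reach_iff_shi_bounds:
  assumes "i < j"
  shows "(reach m f i j \<or> reach m f j i) \<longleftrightarrow> 1 - int m \<le> f i - f j \<and> f i - f j \<le> int m"
  using assms by (auto simp: reach_def before_def)

definition top_vertex :: "(nat \<Rightarrow> int) \<Rightarrow> nat set \<Rightarrow> nat"
  where "top_vertex f B = (THE q. q \<in> B \<and> (\<forall>p\<in>B. p \<noteq> q \<longrightarrow> before f p q))"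

lemma top_vertex_eqI:
  assumes "q \<in> B" "\<And>p. p \<in> B \<Longrightarrow> p \<noteq> q \<Longrightarrow> before f p q"
  shows "top_vertex f B = q"
  unfolding top_vertex_def
  using assms by (intro the_equality) (auto, metis before_trans before_irrefl)

lemma top_vertex:
  assumes "finite B" "B \<noteq> {}"
  shows top_vertex_in: "top_vertex f B \<in> B"
    and top_vertex_after: "\<And>p. p \<in> B \<Longrightarrow> p \<noteq> top_vertex f B \<Longrightarrow> before f p (top_vertex f B)"
proof -
  from assms have "\<exists>q\<in>B. \<forall>p\<in>B. p \<noteq> q \<longrightarrow> before f p q"
  proof (induction rule: finite_ne_induct)
    case (singleton x)
    then show ?case by simp
  next
    case (insert x F)
    then obtain q where "q \<in> F" "\<forall>p\<in>F. p \<noteq> q \<longrightarrow> before f p q" by blast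
    then show ?case
      using before_linear[of f q x] before_trans by (metis insertE insertI1 insertI2)
  qed
  then obtain q where q: "q \<in> B" "\<And>p. p \<in> B \<Longrightarrow> p \<noteq> q \<Longrightarrow> before f p q" by blast
  with top_vertex_eqI[OF q] show "top_vertex f B \<in> B"
    and "\<And>p. p \<in> B \<Longrightarrow> p \<noteq> top_vertex f B \<Longrightarrow> before f p (top_vertex f B)" by auto
qed

section \<open>Counting the height functions of a block\<close>

text \<open>The height functions with which a block can occur in a flat, normalised to minimum \<open>0\<close>.
  Instead of connectedness, the definition demands that every vertex with a predecessor is reached
  from one.  This says the same by the shrinking lemmas, and it is visibly inherited by
  the vertices that remain when the last one is removed.  Values outside \<open>B\<close> are \<open>0\<close>, so that a function is determined by its
  values on the block and functions on disjoint blocks can be glued by adding them.\<close>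

definition heights :: "nat \<Rightarrow> nat set \<Rightarrow> (nat \<Rightarrow> int) set"
  where "heights m B = {f. (\<forall>p. p \<notin> B \<longrightarrow> f p = 0) \<and> (\<forall>p\<in>B. 0 \<le> f p) \<and> (\<exists>p\<in>B. f p = 0) \<and>
    (\<forall>p\<in>B. \<forall>q\<in>B. before f p q \<longrightarrow> (\<exists>r\<in>B. reach m f r q))}"

lemma heights_reached:
  assumes "f \<in> heights m B" "p \<in> B" "q \<in> B" "before f p q"
  obtains r where "r \<in> B" "reach m f r q"
  using assms unfolding heights_def by blast

lemma heights_empty: "heights m {} = {}"
  by (simp add: heights_def)

lemma heights_singleton: "heights m {q} = {\<lambda>_. 0}"
  by (auto simp: heights_def before_def fun_eq_iff)

text \<open>The summand \<open>1\<close> makes \<open>{0..<m}\<close> the range of the parameter \<open>d\<close> in both cases of \<open>reach\<close>: a vertex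
  of smaller index than \<open>l\<close> has to lie strictly higher in order to come after it.\<close>

definition put_above :: "(nat \<Rightarrow> int) \<Rightarrow> nat \<Rightarrow> nat \<Rightarrow> int \<Rightarrow> nat \<Rightarrow> int"
  where "put_above g l q d = g(q := g l + d + (if q < l then 1 else 0))"

lemma put_above_in_heights:
  assumes "finite C" "q \<notin> C" and g: "g \<in> heights m C" and d: "0 \<le> d" "d < int m"
    and l: "l = top_vertex g C"
  shows "put_above g l q d \<in> heights m (insert q C)"
    and "top_vertex (put_above g l q d) (insert q C) = q"
proof -
  let ?f = "put_above g l q d"
  have "C \<noteq> {}" using g by (auto simp: heights_empty)
  note top = top_vertex[OF \<open>finite C\<close> this, where f = g, folded l]
  have f: "?f p = g p" if "p \<in> C" for p
    using that assms(2) by (auto simp: put_above_def)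
  have "q \<noteq> l" using top(1) assms(2) by auto
  then have lq: "reach m ?f l q"
    using d f[OF top(1)] by (auto simp: reach_def before_def put_above_def)
  have last: "before ?f p q" if "p \<in> C" for p
  proof (cases "p = l")
    case True
    then show ?thesis using lq by (simp add: reach_def)
  next
    case False
    then have "before ?f p l" using top that by (simp add: before_def f)
    then show ?thesis using lq before_trans by (auto simp: reach_def)
  qed
  then show "top_vertex ?f (insert q C) = q"
    by (intro top_vertex_eqI) auto
  have "0 \<le> g l" using g top(1) by (auto simp: heights_def)
  then have nonneg: "0 \<le> ?f q" using d by (simp add: put_above_def)
  show "?f \<in> heights m (insert q C)"
    unfolding heights_def
  proof (intro CollectI conjI ballI allI impI)
    fix p assume "p \<notin> insert q C"
    then show "?f p = 0" using g by (auto simp: heights_def put_above_def)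
  next
    fix p assume "p \<in> insert q C"
    then show "0 \<le> ?f p" using nonneg f g by (auto simp: heights_def)
  next
    obtain p where "p \<in> C" "g p = 0" using g by (auto simp: heights_def)
    then show "\<exists>p\<in>insert q C. ?f p = 0" using f by auto
  next
    fix p t assume pt: "p \<in> insert q C" "t \<in> insert q C" "before ?f p t"
    show "\<exists>r\<in>insert q C. reach m ?f r t"
    proof (cases "t = q")
      case True
      then show ?thesis using lq top(1) by blast
    next
      case False
      then have "t \<in> C" using pt by simp
      moreover have "p \<in> C"
        using pt \<open>t \<in> C\<close> last before_trans before_irrefl by blast
      ultimately have "before g p t" using pt(3) f before_cong by metis
      then obtain r where "r \<in> C" "reach m g r t"
        using g \<open>p \<in> C\<close> \<open>t \<in> C\<close> unfolding heights_def by blast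
      then show ?thesis using f \<open>t \<in> C\<close> reach_cong by (metis insertI2)
    qed
  qed
qed

text \<open>The last vertex is reached from some earlier one, hence, by shrinking that edge, from the last but
  one.  This makes \<open>put_above\<close> the only way to build an element of \<open>heights\<close> from one with a vertex less.\<close>

lemma remove_top_in_heights:
  assumes "finite B" and f: "f \<in> heights m B" and q: "q = top_vertex f B" and C: "C = B - {q}" "C \<noteq> {}"
  shows "f(q := 0) \<in> heights m C"
    and "reach m f (top_vertex (f(q := 0)) C) q"
proof -
  let ?g = "f(q := 0)"
  let ?l = "top_vertex ?g C"
  have "B \<noteq> {}" using C by auto
  note top = top_vertex[OF \<open>finite B\<close> this, where f = f, folded q]
  have "finite C" using assms by simp
  note topC = top_vertex[OF \<open>finite C\<close> C(2), where f = ?g]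
  have g: "?g p = f p" if "p \<in> C" for p
    using that C by auto
  have low: "before f p q" if "p \<in> C" for p using that top C by auto
  have lB: "?l \<in> B" using topC(1) C by auto
  obtain r where r: "r \<in> B" "reach m f r q"
    using f lB top(1) low[OF topC(1)] unfolding heights_def by blast
  then have "r \<in> C" using C by (auto simp: reach_def before_irrefl)
  show "reach m f ?l q"
  proof (cases "r = ?l")
    case False
    then have "before ?g r ?l" using topC(2) \<open>r \<in> C\<close> by blast
    then have "before f r ?l" using g[OF \<open>r \<in> C\<close>] g[OF topC(1)] before_cong by metis
    then show ?thesis using reach_shrink_left[OF r(2)] low topC(1) by blast
  qed (use r in simp)
  show "?g \<in> heights m C"
    unfolding heights_def
  proof (intro CollectI conjI ballI allI impI)
    fix p assume "p \<notin> C"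
    then show "?g p = 0" using f C by (auto simp: heights_def)
  next
    fix p assume "p \<in> C"
    then show "0 \<le> ?g p" using g f C by (auto simp: heights_def)
  next
    obtain p where p: "p \<in> B" "f p = 0" using f by (auto simp: heights_def)
    \<comment> \<open>If the vertex of value \<open>0\<close> is the one removed, it came last, so all other values are \<open>0\<close> as well.\<close>
    show "\<exists>p\<in>C. ?g p = 0"
    proof (cases "p = q")
      case True
      then have "f r \<le> 0" using p low[OF \<open>r \<in> C\<close>] by (auto simp: before_def)
      moreover have "0 \<le> f r" using f r by (auto simp: heights_def)
      ultimately show ?thesis using g \<open>r \<in> C\<close> by (metis order_antisym)
    next
      case False
      then show ?thesis using p C by auto
    qed
  next
    fix p t assume pt: "p \<in> C" "t \<in> C" "before ?g p t"
    then have "before f p t" using g before_cong by metis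
    then obtain s where s: "s \<in> B" "reach m f s t"
      using f pt C unfolding heights_def by blast
    then have "s \<noteq> q"
      using low[OF pt(2)] before_trans before_irrefl unfolding reach_def by blast
    then have "s \<in> C" using s C by auto
    then show "\<exists>r\<in>C. reach m ?g r t" using s g pt(2) reach_cong by metis
  qed
qed

lemma bij_betw_put_above:
  assumes "finite B" "2 \<le> card B"
  shows "bij_betw (\<lambda>(q, g, d). put_above g (top_vertex g (B - {q})) q d)
    (SIGMA q:B. heights m (B - {q}) \<times> {0..<int m}) (heights m B)"
proof -
  define rest where "rest f = f(top_vertex f B := 0)" for f :: "nat \<Rightarrow> int"
  define below where "below f = top_vertex (rest f) (B - {top_vertex f B})" for f
  define gap where "gap f = f (top_vertex f B) - f (below f) - (if top_vertex f B < below f then 1 else 0)" for f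
  have ne: "B \<noteq> {}" using assms by auto
  have ne': "B - {q} \<noteq> {}" for q
    using assms card_mono[of "{q}" B] by auto
  show ?thesis
  proof (rule bij_betw_byWitness[where f' = "\<lambda>f. (top_vertex f B, rest f, gap f)"])
    show "\<forall>a\<in>SIGMA q:B. heights m (B - {q}) \<times> {0..<int m}.
      (\<lambda>f. (top_vertex f B, rest f, gap f)) ((\<lambda>(q, g, d). put_above g (top_vertex g (B - {q})) q d) a) = a"
    proof
      fix a assume "a \<in> (SIGMA q:B. heights m (B - {q}) \<times> {0..<int m})"
      then obtain q g d where a: "a = (q, g, d)" and q: "q \<in> B" and g: "g \<in> heights m (B - {q})"
        and d: "d \<in> {0..<int m}" by auto
      define l where "l = top_vertex g (B - {q})"
      let ?f = "put_above g l q d"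
      have "l \<in> B - {q}" unfolding l_def using assms ne' by (intro top_vertex_in) auto
      have top: "top_vertex ?f B = q"
        using put_above_in_heights(2)[OF _ _ g _ _ l_def, of q d] assms q d by (simp add: insert_absorb)
      moreover have rest: "rest ?f = g"
        using g unfolding rest_def top by (auto simp: heights_def put_above_def)
      moreover have "gap ?f = d"
        unfolding gap_def below_def top rest l_def[symmetric]
        using \<open>l \<in> B - {q}\<close> by (simp add: put_above_def)
      ultimately show "(\<lambda>f. (top_vertex f B, rest f, gap f))
          ((\<lambda>(q, g, d). put_above g (top_vertex g (B - {q})) q d) a) = a"
        by (simp add: a l_def[symmetric])
    qed
  next
    show "\<forall>f\<in>heights m B. (\<lambda>(q, g, d). put_above g (top_vertex g (B - {q})) q d)
        (top_vertex f B, rest f, gap f) = f"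
    proof
      fix f assume f: "f \<in> heights m B"
      have "below f \<in> B - {top_vertex f B}"
        unfolding below_def using assms ne' by (intro top_vertex_in) auto
      then have "put_above (rest f) (below f) (top_vertex f B) (gap f) = f"
        by (auto simp: put_above_def gap_def rest_def)
      then show "(\<lambda>(q, g, d). put_above g (top_vertex g (B - {q})) q d)
        (top_vertex f B, rest f, gap f) = f"
        by (simp add: below_def)
    qed
  next
    show "(\<lambda>(q, g, d). put_above g (top_vertex g (B - {q})) q d) `
      (SIGMA q:B. heights m (B - {q}) \<times> {0..<int m}) \<subseteq> heights m B"
    proof clarify
      fix q g d assume "q \<in> B" "g \<in> heights m (B - {q})" "d \<in> {0..<int m}"
      then show "put_above g (top_vertex g (B - {q})) q d \<in> heights m B"
        using put_above_in_heights(1)[of "B - {q}" q g m d] assms by (simp add: insert_absorb)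
    qed
  next
    show "(\<lambda>f. (top_vertex f B, rest f, gap f)) ` heights m B
      \<subseteq> (SIGMA q:B. heights m (B - {q}) \<times> {0..<int m})"
    proof (rule image_subsetI)
      fix f assume f: "f \<in> heights m B"
      note rem = remove_top_in_heights[OF assms(1) f refl refl ne']
      have "below f \<in> B - {top_vertex f B}"
        unfolding below_def using assms ne' by (intro top_vertex_in) auto
      moreover have "reach m f (below f) (top_vertex f B)"
        using rem(2) by (simp add: below_def rest_def)
      ultimately have "gap f \<in> {0..<int m}"
        by (auto simp: gap_def reach_def before_def split: if_splits)
      then show "(top_vertex f B, rest f, gap f) \<in> (SIGMA q:B. heights m (B - {q}) \<times> {0..<int m})"
        using rem(1) top_vertex_in[OF assms(1) ne] by (auto simp: rest_def)
    qed
  qed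
qed

text \<open>Building up a block of size \<open>b\<close> vertex by vertex offers all orders of the vertices and \<open>m\<close> heights
  for each vertex but the first.\<close>

lemma card_heights:
  assumes "finite B" "B \<noteq> {}"
  shows "finite (heights m B)" "card (heights m B) = fact (card B) * m ^ (card B - 1)"
proof -
  have "finite (heights m B) \<and> card (heights m B) = fact (Suc n) * m ^ n" if "card B = Suc n" for n
    using that
  proof (induction n arbitrary: B)
    case 0
    then obtain q where "B = {q}" by (metis One_nat_def card_1_singletonE)
    then show ?case by (simp add: heights_singleton)
  next
    case (Suc n)
    have "finite B" using Suc.prems card.infinite by fastforce
    have IH: "finite (heights m (B - {q}))" "card (heights m (B - {q})) = fact (Suc n) * m ^ n"
      if "q \<in> B" for q using Suc.IH[of "B - {q}"] Suc.prems that by auto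
    have bij: "bij_betw (\<lambda>(q, g, d). put_above g (top_vertex g (B - {q})) q d)
      (SIGMA q:B. heights m (B - {q}) \<times> {0..<int m}) (heights m B)"
      by (rule bij_betw_put_above) (use \<open>finite B\<close> Suc.prems in auto)
    have "card (heights m B) = card (SIGMA q:B. heights m (B - {q}) \<times> {0..<int m})"
      using bij_betw_same_card[OF bij] by simp
    also have "\<dots> = (\<Sum>q\<in>B. fact (Suc n) * m ^ n * m)"
      using \<open>finite B\<close> IH by (subst card_SigmaI) (auto simp: card_cartesian_product intro!: sum.cong)
    also have "\<dots> = fact (Suc (Suc n)) * m ^ Suc n"
      by (simp add: Suc.prems algebra_simps)
    finally show ?case
      using bij_betw_finite[OF bij] \<open>finite B\<close> IH by auto
  qed
  from this[of "card B - 1"] assms show "finite (heights m B)"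
    "card (heights m B) = fact (card B) * m ^ (card B - 1)"
    by (simp_all add: card_gt_0_iff)
qed

section \<open>The exponential formula\<close>

text \<open>Keeping a block together with its structure as a pair allows the same \<open>s\<close> to be a structure on
  several sets.\<close>

definition decorated_partitions :: "('a set \<Rightarrow> 's set) \<Rightarrow> nat \<Rightarrow> 'a set \<Rightarrow> ('a set \<times> 's) set set"
  where "decorated_partitions St k A =
    {S. inj_on fst S \<and> partition_on A (fst ` S) \<and> (\<forall>(B, s)\<in>S. s \<in> St B) \<and> card S = k}"

lemma finite_decorated_partitions:
  assumes "finite A" "\<And>B. B \<subseteq> A \<Longrightarrow> finite (St B)"
  shows "finite (decorated_partitions St k A)"
proof -
  have "decorated_partitions St k A \<subseteq> Pow (Sigma (Pow A) St)"
    by (auto simp: decorated_partitions_def partition_on_def)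
  moreover have "finite (Sigma (Pow A) St)"
    using assms by auto
  ultimately show ?thesis
    by (metis finite_Pow_iff finite_subset)
qed

lemma finite_decorated_partition:
  assumes "S \<in> decorated_partitions St k A" "finite A"
  shows "finite S"
  using assms finite_elements[of A "fst ` S"] finite_imageD
  by (auto simp: decorated_partitions_def)

lemma decorated_partition_insert:
  assumes "finite A" "B \<subseteq> A" "B \<noteq> {}" "s \<in> St B" "T \<in> decorated_partitions St k (A - B)"
  shows "insert (B, s) T \<in> decorated_partitions St (Suc k) A"
proof -
  have T: "inj_on fst T" "partition_on (A - B) (fst ` T)" "\<forall>(B, s)\<in>T. s \<in> St B" "card T = k"
    using assms by (auto simp: decorated_partitions_def)
  have "finite T" using assms finite_decorated_partition by blast
  have new: "B \<notin> fst ` T"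
    using T(2) assms(3) partition_onD1 by fastforce
  then have "(B, s) \<notin> T" by force
  then show ?thesis
    using T new \<open>finite T\<close> assms partition_on_insert[of B "fst ` T" A]
    by (auto simp: decorated_partitions_def partition_on_def disjnt_def pairwise_insert)
qed

lemma decorated_partition_remove:
  assumes "finite A" "S \<in> decorated_partitions St (Suc k) A" "(B, s) \<in> S"
  shows "S - {(B, s)} \<in> decorated_partitions St k (A - B)"
proof -
  have S: "inj_on fst S" "partition_on A (fst ` S)" "\<forall>(B, s)\<in>S. s \<in> St B" "card S = Suc k"
    using assms by (auto simp: decorated_partitions_def)
  have im: "fst ` (S - {(B, s)}) = fst ` S - {B}"
    using inj_on_image_set_diff[OF S(1), of S "{(B, s)}"] assms(3) by simp
  have B: "B \<in> fst ` S" using assms(3) by force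
  have "disjnt B (\<Union>(fst ` S - {B}))"
    using disjointD[OF partition_onD2[OF S(2)] B] unfolding disjnt_def by blast
  then have "partition_on (A - B) (fst ` S - {B})"
    using S(2) partition_on_insert[of B "fst ` S - {B}" A] by (simp add: insert_absorb[OF B])
  then show ?thesis
    using S im assms(3) unfolding decorated_partitions_def by (simp add: inj_on_diff)
qed

lemma decorated_partition_unique_block:
  assumes "S \<in> decorated_partitions St k A" "x \<in> A"
  shows "\<exists>!bs. bs \<in> S \<and> x \<in> fst bs"
proof -
  have S: "inj_on fst S" "\<Union>(fst ` S) = A" "disjoint (fst ` S)"
    using assms by (auto simp: decorated_partitions_def partition_on_def)
  from S(2) assms(2) obtain bs where bs: "bs \<in> S" "x \<in> fst bs" by blast
  show ?thesis
  proof (rule ex1I[of _ bs])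
    fix cs assume cs: "cs \<in> S \<and> x \<in> fst cs"
    then have "fst cs = fst bs"
      using disjointD[OF S(3), of "fst cs" "fst bs"] bs by blast
    then show "cs = bs" using inj_onD[OF S(1)] cs bs by blast
  qed (use bs in simp)
qed

lemma decorated_partition_block_subset:
  assumes "S \<in> decorated_partitions St k A" "(B, s) \<in> S"
  shows "B \<subseteq> A"
proof -
  have "\<Union>(fst ` S) = A" using assms(1) by (simp add: decorated_partitions_def partition_on_def)
  moreover have "B \<in> fst ` S" using assms(2) by force
  ultimately show ?thesis by blast
qed

lemma decorated_partition_same_block:
  assumes "S \<in> decorated_partitions St k A" "(B, s) \<in> S" "(C, t) \<in> S" "p \<in> B" "p \<in> C"
  shows "B = C" "s = t"
proof -
  have "B \<subseteq> A" using decorated_partition_block_subset assms by metis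
  then show "B = C" "s = t"
    using decorated_partition_unique_block[OF assms(1), of p] assms by fastforce+
qed

text \<open>Singling out the block of a fixed element \<open>a\<close> turns an unordered choice of blocks into a
  recursion without any overcounting.\<close>

lemma bij_betw_first_block:
  assumes "finite A" "a \<notin> A"
  shows "bij_betw (\<lambda>(B, s, T). insert (insert a B, s) T)
    (SIGMA B:Pow A. St (insert a B) \<times> decorated_partitions St k (A - B))
    (decorated_partitions St (Suc k) (insert a A))"
proof -
  have diff: "insert a A - insert a B = A - B" if "B \<subseteq> A" for B
    using assms that by auto
  have a_in_T: "a \<notin> C" if "T \<in> decorated_partitions St k (A - B)" "(C, t) \<in> T" for B C T t
  proof -
    have "C \<in> fst ` T" using that by force
    then have "C \<subseteq> A - B" using that by (auto simp: decorated_partitions_def partition_on_def)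
    then show ?thesis using assms by blast
  qed
  show ?thesis
    unfolding bij_betw_def
  proof (intro conjI equalityI subsetI)
    show "inj_on (\<lambda>(B, s, T). insert (insert a B, s) T)
      (SIGMA B:Pow A. St (insert a B) \<times> decorated_partitions St k (A - B))"
    proof (rule inj_onI)
      fix x y
      assume "x \<in> (SIGMA B:Pow A. St (insert a B) \<times> decorated_partitions St k (A - B))"
        and "y \<in> (SIGMA B:Pow A. St (insert a B) \<times> decorated_partitions St k (A - B))"
        and eq': "(\<lambda>(B, s, T). insert (insert a B, s) T) x = (\<lambda>(B, s, T). insert (insert a B, s) T) y"
      then obtain B s T B' s' T' where xy: "x = (B, s, T)" "y = (B', s', T')"
        and "B \<subseteq> A" "B' \<subseteq> A"
        and T: "T \<in> decorated_partitions St k (A - B)" "T' \<in> decorated_partitions St k (A - B')"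
        by auto
      from eq' have eq: "insert (insert a B, s) T = insert (insert a B', s') T'"
        by (simp add: xy)
      have notin: "(insert a C, t) \<notin> T" "(insert a C, t) \<notin> T'" for C t
        using a_in_T[OF T(1)] a_in_T[OF T(2)] by auto
      have "(insert a B, s) \<in> insert (insert a B', s') T'"
        by (subst eq[symmetric]) (rule insertI1)
      then have new: "(insert a B, s) = (insert a B', s')"
        using notin(2)[of B s] by simp
      have "T = T'"
        using insert_ident[THEN iffD1, OF notin(1)[of B' s'] notin(2)[of B' s'] eq[unfolded new]] .
      moreover have "a \<notin> B" "a \<notin> B'"
        using \<open>B \<subseteq> A\<close> \<open>B' \<subseteq> A\<close> assms(2) by blast+
      then have "B = B'"
        using new insert_ident[of a B B'] by simp
      moreover have "s = s'" using new by simp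
      ultimately show "x = y" by (simp add: xy)
    qed
  next
    fix S assume "S \<in> (\<lambda>(B, s, T). insert (insert a B, s) T) `
      (SIGMA B:Pow A. St (insert a B) \<times> decorated_partitions St k (A - B))"
    then obtain B s T where "B \<subseteq> A" "s \<in> St (insert a B)" "T \<in> decorated_partitions St k (A - B)"
      "S = insert (insert a B, s) T" by auto
    then show "S \<in> decorated_partitions St (Suc k) (insert a A)"
      using decorated_partition_insert[of "insert a A" "insert a B" s St T k] assms(1) diff[of B]
      by (simp add: subset_insertI2 insert_mono)
  next
    fix S assume S: "S \<in> decorated_partitions St (Suc k) (insert a A)"
    then obtain C s where Cs: "(C, s) \<in> S" "a \<in> C"
      using decorated_partition_unique_block[OF S, of a] by auto
    then obtain B where B: "C = insert a B" "a \<notin> B" by (meson mk_disjoint_insert)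
    have "C \<in> fst ` S" "\<Union>(fst ` S) = insert a A" "s \<in> St C"
      using S Cs(1) by (force simp: decorated_partitions_def partition_on_def)+
    then have "C \<subseteq> insert a A" by (metis Union_upper)
    then have "B \<subseteq> A" using B by blast
    have "s \<in> St (insert a B)" using \<open>s \<in> St C\<close> B(1) by simp
    moreover have "S - {(C, s)} \<in> decorated_partitions St k (A - B)"
      using decorated_partition_remove[OF _ S Cs(1)] assms diff[OF \<open>B \<subseteq> A\<close>] B(1) by simp
    ultimately have mem: "(B, s, S - {(C, s)}) \<in>
        (SIGMA B:Pow A. St (insert a B) \<times> decorated_partitions St k (A - B))"
      using \<open>B \<subseteq> A\<close> by simp
    have eq: "S = insert (insert a B, s) (S - {(C, s)})"
      unfolding B(1)[symmetric] using Cs(1) by (simp add: insert_absorb)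
    show "S \<in> (\<lambda>(B, s, T). insert (insert a B, s) T) `
      (SIGMA B:Pow A. St (insert a B) \<times> decorated_partitions St k (A - B))"
      by (rule image_eqI[OF _ mem], unfold prod.case, rule eq)
  qed
qed

lemma sum_Pow_by_card:
  fixes h :: "nat \<Rightarrow> 'b::comm_semiring_1"
  assumes "finite A"
  shows "(\<Sum>B\<in>Pow A. h (card B)) = (\<Sum>b\<le>card A. of_nat (card A choose b) * h b)"
proof -
  have "(\<Sum>B\<in>Pow A. h (card B)) = (\<Sum>b\<le>card A. \<Sum>B | B \<in> Pow A \<and> card B = b. h (card B))"
    using assms by (intro sum.group[symmetric]) (auto intro: card_mono)
  also have "\<dots> = (\<Sum>b\<le>card A. of_nat (card A choose b) * h b)"
    using assms by (intro sum.cong) (auto simp: n_subsets)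
  finally show ?thesis .
qed

text \<open>Let \<open>F\<^sub>k\<close> be the exponential generating function of the left-hand sides.  For \<open>k > 0\<close>, both \<open>F\<^sub>k\<close> and
  \<open>C\<^sup>k / k!\<close> have constant term \<open>0\<close>, and their derivatives satisfy the same recursion: the one
  over the block of a fixed element reads \<open>F\<^sub>k\<^sub>+\<^sub>1' = C' F\<^sub>k\<close>, and \<open>(C\<^sup>k\<^sup>+\<^sup>1 / (k+1)!)' = C' C\<^sup>k / k!\<close>.\<close>

lemma card_decorated_partitions:
  includes fps_syntax
  fixes c :: "nat \<Rightarrow> nat" and C :: "'f::field_char_0 fps"
  assumes "finite A"
    and St: "\<And>B. finite B \<Longrightarrow> finite (St B)" "\<And>B. finite B \<Longrightarrow> card (St B) = c (card B)"
    and "c 0 = 0"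
    and C: "C = Abs_fps (\<lambda>n. of_nat (c n) / fact n)"
  shows "of_nat (card (decorated_partitions St k A)) = fact (card A) * (fps_const (1 / fact k) * C ^ k) $ card A"
  using \<open>finite A\<close>
proof (induction k arbitrary: A)
  case 0
  have "S = {}" if "S \<in> decorated_partitions St 0 A" for S
    using finite_decorated_partition[OF that 0] that by (simp add: decorated_partitions_def)
  moreover have "{} \<in> decorated_partitions St 0 A \<longleftrightarrow> A = {}"
    by (auto simp: decorated_partitions_def partition_on_def)
  ultimately have "decorated_partitions St 0 A = (if A = {} then {{}} else {})"
    by auto
  then show ?case using 0 by auto
next
  case (Suc k)
  let ?F = "\<lambda>k. fps_const (1 / fact k) * C ^ k"
  show ?case
  proof (cases "A = {}")
    case True
    then have "decorated_partitions St (Suc k) A = {}"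
      by (auto simp: decorated_partitions_def partition_on_empty)
    moreover have "?F (Suc k) $ 0 = 0"
      using \<open>c 0 = 0\<close> by (simp add: C fps_power_zeroth)
    ultimately show ?thesis using True by simp
  next
    case False
    then obtain a A' where A: "A = insert a A'" "a \<notin> A'" by (meson Set.set_insert all_not_in_conv)
    then have fin: "finite A'" using Suc by simp
    let ?n = "card A'"
    have sub: "finite B" "card (A' - B) = ?n - card B" "card (insert a B) = Suc (card B)" if "B \<subseteq> A'" for B
    proof -
      show "finite B" using finite_subset[OF that fin] .
      moreover have "a \<notin> B" using that A(2) by blast
      ultimately show "card (A' - B) = ?n - card B" "card (insert a B) = Suc (card B)"
        using that by (simp_all add: card_Diff_subset)
    qed
    have deriv: "fps_deriv (?F (Suc k)) = fps_deriv C * ?F k"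
    proof -
      have "fps_const (1 / fact (Suc k)) * fps_const (of_nat (Suc k)) = (fps_const (1 / fact k) :: 'f fps)"
        unfolding fps_const_mult by (simp del: of_nat_Suc)
      moreover have "fps_deriv (?F (Suc k)) =
          fps_const (1 / fact (Suc k)) * fps_const (of_nat (Suc k)) * (fps_deriv C * C ^ k)"
        by (simp add: fps_deriv_power mult.assoc del: of_nat_Suc fps_const_mult power_Suc fact_Suc)
      ultimately show ?thesis by (simp add: mult.left_commute)
    qed
    have "of_nat (card (decorated_partitions St (Suc k) A)) =
      (of_nat (card (SIGMA B:Pow A'. St (insert a B) \<times> decorated_partitions St k (A' - B))) :: 'f)"
      unfolding A(1) by (simp only: bij_betw_same_card[OF bij_betw_first_block[OF fin A(2)]])
    also have "\<dots> = (\<Sum>B\<in>Pow A'. of_nat (c (Suc (card B))) * (fact (?n - card B) * ?F k $ (?n - card B)))"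
    proof -
      have "finite (St (insert a B) \<times> decorated_partitions St k (A' - B))" if "B \<subseteq> A'" for B
      proof (intro finite_cartesian_product finite_decorated_partitions)
        show "finite (St D)" if "D \<subseteq> A' - B" for D
          using St(1) finite_subset[OF that] fin by simp
      qed (use St(1) sub(1)[OF that] fin in auto)
      then have "card (SIGMA B:Pow A'. St (insert a B) \<times> decorated_partitions St k (A' - B)) =
          (\<Sum>B\<in>Pow A'. card (St (insert a B)) * card (decorated_partitions St k (A' - B)))"
        using fin by (subst card_SigmaI) (simp_all add: card_cartesian_product)
      moreover have "of_nat (card (St (insert a B)) * card (decorated_partitions St k (A' - B))) =
          of_nat (c (Suc (card B))) * (fact (?n - card B) * ?F k $ (?n - card B))" if "B \<subseteq> A'" for B
        using St(2)[of "insert a B"] sub[OF that] Suc.IH[of "A' - B"] fin by simp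
      ultimately show ?thesis by (simp only: of_nat_sum) (rule sum.cong, simp_all)
    qed
    also have "\<dots> = (\<Sum>b\<le>?n. of_nat (?n choose b) * (of_nat (c (Suc b)) * (fact (?n - b) * ?F k $ (?n - b))))"
      by (rule sum_Pow_by_card[OF fin])
    also have "\<dots> = (\<Sum>b\<le>?n. fact ?n * (fps_deriv C $ b * ?F k $ (?n - b)))"
    proof (rule sum.cong)
      fix b assume "b \<in> {..?n}"
      then have "(of_nat (?n choose b) :: 'f) = fact ?n / (fact b * fact (?n - b))"
        by (simp add: binomial_fact)
      moreover have "fps_deriv C $ b = of_nat (c (Suc b)) / fact b"
        by (simp add: C field_simps del: of_nat_Suc)
      ultimately show "of_nat (?n choose b) * (of_nat (c (Suc b)) * (fact (?n - b) * ?F k $ (?n - b)))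
        = fact ?n * (fps_deriv C $ b * ?F k $ (?n - b))"
        by (simp only:) simp
    qed simp
    also have "\<dots> = fact ?n * fps_deriv (?F (Suc k)) $ ?n"
      unfolding deriv fps_mult_nth sum_distrib_left by (simp add: atLeast0AtMost)
    also have "\<dots> = fact (card A) * ?F (Suc k) $ card A"
    proof -
      have "card A = Suc ?n" using A fin by simp
      then show ?thesis by (simp only: fps_deriv_nth fact_Suc Suc_eq_plus1[symmetric] mult_ac)
    qed
    finally show ?thesis .
  qed
qed

section \<open>From decorated partitions to flats\<close>

definition coord_vector :: "nat \<Rightarrow> (nat \<Rightarrow> real) \<Rightarrow> (nat \<Rightarrow>\<^sub>0 real)"
  where "coord_vector n h = Abs_poly_mapping (\<lambda>p. if p \<in> {1..n} then h p else 0)"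

lemma lookup_coord_vector: "Poly_Mapping.lookup (coord_vector n h) p = (if p \<in> {1..n} then h p else 0)"
proof -
  have "finite {p. (if p \<in> {1..n} then h p else 0) \<noteq> 0}"
    by (rule finite_subset[of _ "{1..n}"]) auto
  then show ?thesis by (simp add: coord_vector_def)
qed

lemma coord_vector_in: "coord_vector n h \<in> coord_space n"
  by (auto simp: coord_space_def in_keys_iff lookup_coord_vector split: if_splits)

lemma coord_space_lookup: "x \<in> coord_space n \<Longrightarrow> p \<notin> {1..n} \<Longrightarrow> Poly_Mapping.lookup x p = 0"
  by (auto simp: coord_space_def in_keys_iff)

lemma lookup_scaleR: "Poly_Mapping.lookup (c *\<^sub>R x) p = c * Poly_Mapping.lookup x p"
  for x :: "'a \<Rightarrow>\<^sub>0 real"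
proof -
  have "finite {i. c * Poly_Mapping.lookup x i \<noteq> 0}"
    by (rule finite_subset[OF _ finite_lookup[of x]]) auto
  then show ?thesis by (simp add: scaleR_poly_mapping_def)
qed

lemma coord_space_add: "x \<in> coord_space n \<Longrightarrow> y \<in> coord_space n \<Longrightarrow> x + y \<in> coord_space n"
  using keys_add[of x y] by (auto simp: coord_space_def)

lemma coord_space_diff: "x \<in> coord_space n \<Longrightarrow> y \<in> coord_space n \<Longrightarrow> x - y \<in> coord_space n"
  using keys_diff[of x y] by (auto simp: coord_space_def)

definition flat_of :: "nat \<Rightarrow> (nat set \<times> (nat \<Rightarrow> int)) set \<Rightarrow> (nat \<Rightarrow>\<^sub>0 real) set"
  where "flat_of n S = {x \<in> coord_space n. \<forall>(B, f)\<in>S. \<forall>p\<in>B. \<forall>q\<in>B.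
    Poly_Mapping.lookup x p - Poly_Mapping.lookup x q = of_int (f p - f q)}"

lemma flat_ofD:
  assumes "x \<in> flat_of n S" "(B, f) \<in> S" "p \<in> B" "q \<in> B"
  shows "Poly_Mapping.lookup x p - Poly_Mapping.lookup x q = of_int (f p - f q)"
  using assms by (auto simp: flat_of_def)

context
  fixes m n k :: nat and S
  assumes S: "S \<in> decorated_partitions (heights m) k {1..n}"
begin

lemma decorated_partition_heights: "(B, f) \<in> S \<Longrightarrow> f \<in> heights m B"
  using S by (auto simp: decorated_partitions_def)

lemma decorated_partition_subset: "(B, f) \<in> S \<Longrightarrow> B \<subseteq> {1..n}"
  using decorated_partition_block_subset[OF S] .

lemma decorated_partition_cover: "p \<in> {1..n} \<Longrightarrow> \<exists>B f. (B, f) \<in> S \<and> p \<in> B"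
proof -
  assume "p \<in> {1..n}"
  then have "p \<in> \<Union>(fst ` S)" using S by (simp add: decorated_partitions_def partition_on_def)
  then show ?thesis by auto
qed

lemma flat_of_add_indicator:
  assumes "x \<in> flat_of n S" "(C, g) \<in> S"
  shows "x + coord_vector n (indicator C) \<in> flat_of n S"
proof -
  have same: "Poly_Mapping.lookup (coord_vector n (indicator C)) p =
      Poly_Mapping.lookup (coord_vector n (indicator C)) q"
    if "(B, f) \<in> S" "p \<in> B" "q \<in> B" for B f p q
  proof -
    have "p \<in> C \<longleftrightarrow> q \<in> C"
      using decorated_partition_same_block(1)[OF S that(1) assms(2)] that(2,3) by blast
    moreover have "p \<in> {1..n}" "q \<in> {1..n}"
      using decorated_partition_subset[OF that(1)] that(2,3) by blast+
    ultimately show ?thesis by (simp add: lookup_coord_vector indicator_def)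
  qed
  have "Poly_Mapping.lookup (x + coord_vector n (indicator C)) p -
      Poly_Mapping.lookup (x + coord_vector n (indicator C)) q = of_int (f p - f q)"
    if "(B, f) \<in> S" "p \<in> B" "q \<in> B" for B f p q
    using flat_ofD[OF assms(1) that] same[OF that] unfolding lookup_add by simp
  moreover have "x + coord_vector n (indicator C) \<in> coord_space n"
    using assms(1) by (intro coord_space_add coord_vector_in) (simp add: flat_of_def)
  ultimately show ?thesis unfolding flat_of_def by blast
qed

text \<open>All the height functions can be realised by a single vector because they concern disjoint sets of
  coordinates: their sum restricts to each of them.\<close>

lemma flat_of_nonempty: "flat_of n S \<noteq> {}"
proof -
  have fin: "finite S" using finite_decorated_partition[OF S] by simp
  define h where "h p = (\<Sum>(B, f)\<in>S. f p)" for p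
  have h: "h p = f p" if "(B, f) \<in> S" "p \<in> B" for B f p
  proof -
    have "g p = 0" if "(C, g) \<in> S - {(B, f)}" for C g
    proof -
      have "p \<notin> C"
        using decorated_partition_same_block[OF S \<open>(B, f) \<in> S\<close>, of C g p] \<open>p \<in> B\<close> that by blast
      then show ?thesis using decorated_partition_heights[of C g] that by (simp add: heights_def)
    qed
    then have "(\<Sum>(C, g)\<in>S - {(B, f)}. g p) = 0"
      by (intro sum.neutral) auto
    then show ?thesis using sum.remove[OF fin that(1), of "\<lambda>(B, f). f p"] by (simp add: h_def)
  qed
  have "coord_vector n (\<lambda>p. of_int (h p)) \<in> flat_of n S"
    unfolding flat_of_def
  proof (intro CollectI conjI coord_vector_in ballI, clarify)
    fix B f p q assume *: "(B, f) \<in> S" "p \<in> B" "q \<in> B"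
    then have "p \<in> {1..n}" "q \<in> {1..n}" using decorated_partition_subset by blast+
    then show "Poly_Mapping.lookup (coord_vector n (\<lambda>p. of_int (h p))) p -
      Poly_Mapping.lookup (coord_vector n (\<lambda>p. of_int (h p))) q = of_int (f p - f q)"
      using h[OF *(1)] * by (simp add: lookup_coord_vector)
  qed
  then show ?thesis by blast
qed

text \<open>Translating a single block moves points within the flat.  So the flat alone determines the blocks:
  coordinates from different blocks have no constant difference.\<close>

lemma constant_difference_same_block:
  assumes "p \<in> {1..n}" "q \<in> {1..n}"
    and const: "\<And>x y. x \<in> flat_of n S \<Longrightarrow> y \<in> flat_of n S \<Longrightarrow>
      Poly_Mapping.lookup x p - Poly_Mapping.lookup x q = Poly_Mapping.lookup y p - Poly_Mapping.lookup y q"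
    and "(C, g) \<in> S" "p \<in> C"
  shows "q \<in> C"
proof (rule ccontr)
  assume "q \<notin> C"
  obtain x where x: "x \<in> flat_of n S" using flat_of_nonempty by blast
  from const[OF x flat_of_add_indicator[OF x \<open>(C, g) \<in> S\<close>]] assms \<open>q \<notin> C\<close>
  show False by (simp add: lookup_add lookup_coord_vector)
qed

text \<open>The hyperplanes that contain \<open>flat_of n S\<close> cut out nothing larger: every vertex is linked by such a
  hyperplane to an earlier vertex of its block, so all differences within a block are forced.\<close>

lemma flat_of_in_flats: "flat_of n S \<in> flats (coord_space n) (shi_arrangement m n)"
proof -
  have subset: "flat_of n S \<subseteq> coord_space n" by (auto simp: flat_of_def)
  let ?\<B> = "{H \<in> shi_arrangement m n. flat_of n S \<subseteq> H}"
  have "x \<in> flat_of n S" if x: "x \<in> coord_space n" "x \<in> \<Inter>?\<B>" for x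
  proof -
    let ?x = "Poly_Mapping.lookup x"
    have edge: "?x q - ?x p = of_int (f q - f p)"
      if Bf: "(B, f) \<in> S" "p \<in> B" "q \<in> B" and "reach m f p q" for B f p q
    proof -
      define i j where "i = min p q" and "j = max p q"
      have "p \<noteq> q" using that by (auto simp: reach_def before_irrefl)
      then have ij: "i < j" "i \<in> B" "j \<in> B" "(i = p \<and> j = q) \<or> (i = q \<and> j = p)"
        using Bf by (auto simp: i_def j_def min_def max_def)
      define H where "H = {x \<in> coord_space n. Poly_Mapping.lookup x i - Poly_Mapping.lookup x j = of_int (f i - f j)}"
      have "1 - int m \<le> f i - f j" "f i - f j \<le> int m"
        using reach_iff_shi_bounds[OF ij(1), of m f] ij(4) that(4) by auto
      moreover have "1 \<le> i" "j \<le> n" using decorated_partition_subset[OF Bf(1)] ij by auto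
      ultimately have "H \<in> shi_arrangement m n"
        unfolding shi_arrangement_def H_def using ij(1)
        by (intro CollectI exI[of _ i] exI[of _ j] exI[of _ "f i - f j"]) simp
      moreover have "flat_of n S \<subseteq> H"
        using flat_ofD[OF _ Bf(1) ij(2,3)] subset by (auto simp: H_def)
      ultimately have "x \<in> H" by (intro InterD[OF x(2)]) simp
      then show ?thesis using ij(4) by (auto simp: H_def)
    qed
    have diff: "?x q - ?x p = of_int (f q - f p)"
      if Bf: "(B, f) \<in> S" and "p \<in> B" "q \<in> B" "before f p q" for B f p q
      using that(2-)
      \<comment> \<open>Induction on the positions of both vertices in the sorted block: the later vertex \<open>q\<close> is replaced
        by an earlier \<open>r\<close> that reaches it, and \<open>r\<close> may come before or after \<open>p\<close>.\<close>
    proof (induction "card {r \<in> B. before f r p} + card {r \<in> B. before f r q}" arbitrary: p q rule: less_induct)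
      case less
      have fin: "finite B" using decorated_partition_subset[OF Bf] finite_subset by blast
      obtain r where r: "r \<in> B" "reach m f r q"
        using heights_reached[OF decorated_partition_heights[OF Bf] less.prems] by blast
      then have rq: "before f r q" by (simp add: reach_def)
      have mono: "card {s \<in> B. before f s r} < card {s \<in> B. before f s q}"
      proof (rule psubset_card_mono)
        show "{s \<in> B. before f s r} \<subset> {s \<in> B. before f s q}"
          using r(1) rq before_trans[OF _ rq] before_irrefl[of f r] by blast
      qed (use fin in simp)
      consider "p = r" | "before f p r" | "before f r p" using before_linear[of f p r] by blast
      then show ?case
      proof cases
        case 1
        then show ?thesis using edge[OF Bf r(1) less.prems(2) r(2)] by (simp only:)
      next
        case 2
        have "?x r - ?x p = of_int (f r - f p)"
          by (rule less.hyps[OF _ less.prems(1) r(1) 2]) (use mono in linarith)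
        then show ?thesis
          using edge[OF Bf r(1) less.prems(2) r(2)] unfolding of_int_diff by linarith
      next
        case 3
        have "?x p - ?x r = of_int (f p - f r)"
          by (rule less.hyps[OF _ r(1) less.prems(1) 3]) (use mono in linarith)
        then show ?thesis
          using edge[OF Bf r(1) less.prems(2) r(2)] unfolding of_int_diff by linarith
      qed
    qed
    have "?x p - ?x q = of_int (f p - f q)" if "(B, f) \<in> S" "p \<in> B" "q \<in> B" for B f p q
    proof -
      consider "p = q" | "before f p q" | "before f q p" using before_linear[of f p q] by blast
      then show ?thesis
        by cases (use diff[OF that(1), of p q] diff[OF that(1), of q p] that in simp_all)
    qed
    then show ?thesis using x(1) by (auto simp: flat_of_def simp del: of_int_diff)
  qed
  then have "coord_space n \<inter> \<Inter>?\<B> \<subseteq> flat_of n S" by (intro subsetI) simp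
  moreover have "flat_of n S \<subseteq> coord_space n \<inter> \<Inter>?\<B>"
    using subset by (intro Int_greatest Inter_greatest) simp_all
  ultimately have "flat_of n S = coord_space n \<inter> \<Inter>?\<B>" by (simp only: subset_antisym)
  then show ?thesis
    unfolding flats_def using flat_of_nonempty
    by (intro CollectI conjI exI[of _ ?\<B>]) simp_all
qed

text \<open>The indicator vectors of the blocks form a basis of the direction space, which consists of the
  vectors that are constant on each block.\<close>

lemma affine_dim_flat_of: "affine_dim (flat_of n S) = k"
proof -
  define e where "e bf = coord_vector n (indicator (fst bf))" for bf :: "nat set \<times> (nat \<Rightarrow> int)"
  have fin: "finite S" using finite_decorated_partition[OF S] by simp
  have lookup_e: "Poly_Mapping.lookup (e bf) p = (if bf = (B, f) then 1 else 0)"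
    if "bf \<in> S" "(B, f) \<in> S" "p \<in> B" for bf B f p
  proof -
    obtain C g where bf: "bf = (C, g)" by (cases bf)
    have "p \<in> {1..n}" using decorated_partition_subset[OF that(2)] that(3) by blast
    moreover have "p \<in> C \<longleftrightarrow> (C, g) = (B, f)"
      using decorated_partition_same_block[OF S that(2), of C g p] that bf by auto
    ultimately show ?thesis by (simp add: e_def bf lookup_coord_vector indicator_def)
  qed
  \<comment> \<open>The coefficient of a block is the value at any of its vertices; this yields both linear
    independence and the expansion of a direction vector.\<close>
  have sum_e: "Poly_Mapping.lookup (\<Sum>bf\<in>S. c bf *\<^sub>R e bf) p = c (B, f)"
    if "(B, f) \<in> S" "p \<in> B" for c B f p
  proof -
    have "Poly_Mapping.lookup (\<Sum>bf\<in>S. c bf *\<^sub>R e bf) p = (\<Sum>bf\<in>S. c bf * Poly_Mapping.lookup (e bf) p)"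
      by (simp add: lookup_sum lookup_scaleR)
    also have "\<dots> = (\<Sum>bf\<in>S. if bf = (B, f) then c bf else 0)"
      using lookup_e[OF _ that] by (intro sum.cong refl) auto
    also have "\<dots> = c (B, f)" using fin that by simp
    finally show ?thesis .
  qed
  have block_ne: "B \<noteq> {}" if "(B, f) \<in> S" for B f
    using decorated_partition_heights[OF that] by (auto simp: heights_def)
  have inj: "inj_on e S"
  proof (rule inj_onI)
    fix bf cg assume *: "bf \<in> S" "cg \<in> S" "e bf = e cg"
    obtain B f where bf: "bf = (B, f)" by (cases bf)
    obtain p where "p \<in> B" using block_ne *(1) bf by blast
    then have "Poly_Mapping.lookup (e cg) p = 1" using lookup_e[of bf B f p] * bf by simp
    then show "bf = cg" using \<open>p \<in> B\<close> lookup_e[of cg B f p] *(1,2) bf by (simp split: if_splits)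
  qed
  have indep: "independent (e ` S)"
  proof (rule independent_if_scalars_zero)
    fix c x assume c: "(\<Sum>x\<in>e ` S. c x *\<^sub>R x) = 0" "x \<in> e ` S"
    then obtain B f where Bf: "(B, f) \<in> S" "x = e (B, f)" by auto
    obtain p where "p \<in> B" using block_ne Bf by blast
    have "(\<Sum>bf\<in>S. c (e bf) *\<^sub>R e bf) = 0"
      using c(1) by (simp add: sum.reindex[OF inj])
    then show "c x = 0" using sum_e[OF Bf(1) \<open>p \<in> B\<close>, of "\<lambda>bf. c (e bf)"] Bf by simp
  qed (use fin in simp)
  define D where "D = {x - y | x y. x \<in> flat_of n S \<and> y \<in> flat_of n S}"
  have "span (e ` S) = span D"
  proof (rule span_eq[THEN iffD2], rule conjI)
    show "e ` S \<subseteq> span D"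
    proof clarify
      fix B f assume Bf: "(B, f) \<in> S"
      obtain x where x: "x \<in> flat_of n S" using flat_of_nonempty by blast
      have "coord_vector n (indicator B) = (x + coord_vector n (indicator B)) - x" by simp
      then have "coord_vector n (indicator B) \<in> D"
        unfolding D_def using x flat_of_add_indicator[OF x Bf] by blast
      then show "e (B, f) \<in> span D" by (simp add: e_def span_base)
    qed
  next
    show "D \<subseteq> span (e ` S)"
    proof
      fix v assume "v \<in> D"
      then obtain x y where v: "v = x - y" "x \<in> flat_of n S" "y \<in> flat_of n S" by (auto simp: D_def)
      define c where "c = (\<lambda>(B, f :: nat \<Rightarrow> int). Poly_Mapping.lookup v (SOME p. p \<in> B))"
      have "v = (\<Sum>bf\<in>S. c bf *\<^sub>R e bf)"
      proof (rule poly_mapping_eqI)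
        fix p
        show "Poly_Mapping.lookup v p = Poly_Mapping.lookup (\<Sum>bf\<in>S. c bf *\<^sub>R e bf) p"
        proof (cases "p \<in> {1..n}")
          case True
          then obtain B f where Bf: "(B, f) \<in> S" "p \<in> B" using decorated_partition_cover by blast
          have "(SOME p. p \<in> B) \<in> B" using Bf(2) by (rule someI)
          then have "Poly_Mapping.lookup v p = c (B, f)"
            using flat_ofD[OF v(2) Bf(1,2)] flat_ofD[OF v(3) Bf(1,2)]
            by (fastforce simp: c_def v(1) lookup_minus)
          then show ?thesis using sum_e[OF Bf] by simp
        next
          case False
          then have "Poly_Mapping.lookup (e bf) p = 0" for bf
            by (simp only: e_def lookup_coord_vector if_False)
          then have "Poly_Mapping.lookup (\<Sum>bf\<in>S. c bf *\<^sub>R e bf) p = 0"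
            by (simp add: lookup_sum lookup_scaleR)
          moreover have "v \<in> coord_space n" using v coord_space_diff by (auto simp: flat_of_def)
          ultimately show ?thesis using False coord_space_lookup by metis
        qed
      qed
      then show "v \<in> span (e ` S)"
        by (auto intro!: span_sum span_scale intro: span_base)
    qed
  qed
  then have "dim D = card (e ` S)"
    using indep by (rule dim_eq_card)
  also have "\<dots> = k"
    using S card_image[OF inj] by (simp add: decorated_partitions_def)
  finally show ?thesis by (simp add: affine_dim_def D_def)
qed

end

text \<open>A flat determines its blocks by \<open>constant_difference_same_block\<close> and the height functions up to
  translation, which the minimum \<open>0\<close> excludes.\<close>

lemma flat_of_eq_imp_subset:
  assumes S: "S \<in> decorated_partitions (heights m) k {1..n}"
    and T: "T \<in> decorated_partitions (heights m) l {1..n}"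
    and eq: "flat_of n S = flat_of n T"
  shows "S \<subseteq> T"
proof clarify
  fix B f assume Bf: "(B, f) \<in> S"
  note fB = decorated_partition_heights[OF S Bf] decorated_partition_subset[OF S Bf]
  obtain p where "p \<in> B" using fB by (auto simp: heights_def)
  then obtain C g where Cg: "(C, g) \<in> T" "p \<in> C"
    using decorated_partition_cover[OF T] fB by blast
  note gC = decorated_partition_heights[OF T Cg(1)] decorated_partition_subset[OF T Cg(1)]
  have "q \<in> C" if "q \<in> B" for q
  proof (rule constant_difference_same_block[OF T _ _ _ Cg])
    fix x y assume "x \<in> flat_of n T" "y \<in> flat_of n T"
    then have "x \<in> flat_of n S" "y \<in> flat_of n S" using eq by simp_all
    from this[THEN flat_ofD[OF _ Bf \<open>p \<in> B\<close> that]] show "Poly_Mapping.lookup x p - Poly_Mapping.lookup x q = Poly_Mapping.lookup y p - Poly_Mapping.lookup y q"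
      by simp
  qed (use that \<open>p \<in> B\<close> fB in auto)
  moreover have "q \<in> B" if "q \<in> C" for q
  proof (rule constant_difference_same_block[OF S _ _ _ Bf \<open>p \<in> B\<close>])
    fix x y assume "x \<in> flat_of n S" "y \<in> flat_of n S"
    then have "x \<in> flat_of n T" "y \<in> flat_of n T" using eq by simp_all
    from this[THEN flat_ofD[OF _ Cg(1) Cg(2) that]] show "Poly_Mapping.lookup x p - Poly_Mapping.lookup x q = Poly_Mapping.lookup y p - Poly_Mapping.lookup y q"
      by simp
  qed (use that Cg gC in auto)
  ultimately have BC: "B = C" by blast
  obtain x where x: "x \<in> flat_of n S" using flat_of_nonempty[OF S] by blast
  have diff: "f q - f r = g q - g r" if "q \<in> B" "r \<in> B" for q r
    using flat_ofD[OF x Bf that] flat_ofD[OF x[unfolded eq] Cg(1), of q r] that BC by simp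
  obtain a where a: "a \<in> B" "f a = 0" using fB by (auto simp: heights_def)
  obtain b where b: "b \<in> B" "g b = 0" using gC BC by (auto simp: heights_def)
  have "0 \<le> g a" "0 \<le> f b" using a b fB gC BC by (auto simp: heights_def)
  then have "g a = 0" using diff[OF a(1) b(1)] a b by simp
  have "f = g"
  proof
    fix q show "f q = g q"
      using diff[OF _ a(1), of q] a \<open>g a = 0\<close> fB gC BC by (cases "q \<in> B") (auto simp: heights_def)
  qed
  then show "(B, f) \<in> T" using Cg BC by simp
qed

lemma flat_of_inj:
  assumes "S \<in> decorated_partitions (heights m) k {1..n}"
    and "T \<in> decorated_partitions (heights m) l {1..n}"
    and "flat_of n S = flat_of n T"
  shows "S = T"
  using assms flat_of_eq_imp_subset by (metis subset_antisym)

section \<open>Every flat arises from a decorated partition\<close>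

text \<open>The blocks are the classes of coordinates with constant difference on the flat \<open>X\<close>, and the
  heights are those of an arbitrary point \<open>x\<^sub>0\<close> of \<open>X\<close>, moved down to minimum \<open>0\<close>.  Integrality of the
  differences and the condition in \<open>heights\<close> both follow from one principle (\<open>cut\<close>): a
  set \<open>U\<close> of coordinates that separates two members of a block is crossed by one of the hyperplanes
  that define \<open>X\<close>.  Otherwise \<open>x\<^sub>0\<close> could be moved along the indicator vector of \<open>U\<close> without leaving \<open>X\<close>,
  which would change a difference that is constant on \<open>X\<close>.\<close>

lemma flats_cases:
  assumes "X \<in> flats (coord_space n) (shi_arrangement m n)"
  obtains S where "S \<in> decorated_partitions (heights m) (card S) {1..n}" "X = flat_of n S"
proof -
  obtain \<B> x0 where \<B>: "\<B> \<subseteq> shi_arrangement m n" and X: "X = coord_space n \<inter> \<Inter>\<B>" and x0: "x0 \<in> X"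
    using assms unfolding flats_def by blast
  let ?x0 = "Poly_Mapping.lookup x0"
  define rel where "rel p q \<longleftrightarrow> (\<forall>x\<in>X. Poly_Mapping.lookup x p - Poly_Mapping.lookup x q = ?x0 p - ?x0 q)" for p q
  define linked where "linked i j \<longleftrightarrow> i \<in> {1..n} \<and> j \<in> {1..n} \<and> i < j \<and>
    (\<exists>a. 1 - int m \<le> a \<and> a \<le> int m \<and>
      {x \<in> coord_space n. Poly_Mapping.lookup x i - Poly_Mapping.lookup x j = of_int a} \<in> \<B>)" for i j
  have rel_refl: "rel p p" for p by (simp add: rel_def)
  have rel_sym: "rel q p" if "rel p q" for p q
    using that unfolding rel_def by (metis minus_diff_eq)
  have rel_trans: "rel p r" if "rel p q" "rel q r" for p q r
    unfolding rel_def
  proof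
    fix x assume "x \<in> X"
    with that have "Poly_Mapping.lookup x p - Poly_Mapping.lookup x q = ?x0 p - ?x0 q"
      "Poly_Mapping.lookup x q - Poly_Mapping.lookup x r = ?x0 q - ?x0 r" by (simp_all add: rel_def)
    then show "Poly_Mapping.lookup x p - Poly_Mapping.lookup x r = ?x0 p - ?x0 r" by linarith
  qed
  have hyperplane: "\<exists>i j a. linked i j \<and> H = {x \<in> coord_space n. Poly_Mapping.lookup x i - Poly_Mapping.lookup x j = of_int a}"
    if H: "H \<in> \<B>" for H
  proof -
    have "H \<in> shi_arrangement m n" using \<B> H by blast
    then obtain i j a where *: "H = {x \<in> coord_space n. Poly_Mapping.lookup x i - Poly_Mapping.lookup x j = of_int a}"
      "1 \<le> i" "i < j" "j \<le> n" "1 - int m \<le> a" "a \<le> int m"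
      unfolding shi_arrangement_def by blast
    then have "linked i j"
      unfolding linked_def using H by (intro conjI exI[of _ a]) auto
    then show ?thesis using *(1) by blast
  qed
  have linkedD: "rel i j \<and> (\<exists>a. 1 - int m \<le> a \<and> a \<le> int m \<and> ?x0 i - ?x0 j = of_int a)" if "linked i j" for i j
  proof -
    obtain a where a: "1 - int m \<le> a" "a \<le> int m"
      and H: "{x \<in> coord_space n. Poly_Mapping.lookup x i - Poly_Mapping.lookup x j = of_int a} \<in> \<B>"
      using \<open>linked i j\<close> unfolding linked_def by blast
    have "Poly_Mapping.lookup x i - Poly_Mapping.lookup x j = of_int a" if "x \<in> X" for x
    proof -
      have "x \<in> \<Inter>\<B>" using that X by simp
      from InterD[OF this H] show ?thesis by simp
    qed
    then show ?thesis using a x0 unfolding rel_def by metis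
  qed
  have cut: "\<exists>s t. (linked s t \<or> linked t s) \<and> s \<in> U \<and> t \<notin> U"
    if U: "U \<subseteq> {1..n}" "p \<in> U" "q \<notin> U" "rel p q" "q \<in> {1..n}" for U p q
  proof (rule ccontr)
    assume no: "\<nexists>s t. (linked s t \<or> linked t s) \<and> s \<in> U \<and> t \<notin> U"
    define y where "y = x0 + coord_vector n (indicator U)"
    have y: "Poly_Mapping.lookup y r = ?x0 r + indicator U r" if "r \<in> {1..n}" for r
      using that by (simp add: y_def lookup_add lookup_coord_vector)
    have "y \<in> coord_space n"
      unfolding y_def using x0 X by (intro coord_space_add coord_vector_in) simp
    moreover have "y \<in> H" if H: "H \<in> \<B>" for H
    proof -
      obtain i j a where ij: "linked i j"
        and Heq: "H = {x \<in> coord_space n. Poly_Mapping.lookup x i - Poly_Mapping.lookup x j = of_int a}"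
        using hyperplane[OF H] by blast
      have "x0 \<in> \<Inter>\<B>" using x0 X by simp
      from InterD[OF this H] have "?x0 i - ?x0 j = of_int a" by (simp add: Heq)
      moreover have "i \<in> U \<longleftrightarrow> j \<in> U" using no ij by blast
      moreover have "i \<in> {1..n}" "j \<in> {1..n}" using ij by (simp_all add: linked_def)
      ultimately show ?thesis
        using \<open>y \<in> coord_space n\<close> by (simp add: Heq y indicator_def)
    qed
    ultimately have "y \<in> X" using X by blast
    then have "Poly_Mapping.lookup y p - Poly_Mapping.lookup y q = ?x0 p - ?x0 q"
      using \<open>rel p q\<close> by (simp add: rel_def)
    moreover have "p \<in> {1..n}" using U(1,2) by blast
    ultimately show False using y U by simp
  qed
  define block where "block p = {q \<in> {1..n}. rel p q}" for p
  have block_closed: "t \<in> block p" if "linked s t \<or> linked t s" "s \<in> block p" for s t p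
    using that linkedD rel_sym rel_trans unfolding block_def linked_def by blast
  have block_eq: "block p = block q" if "rel p q" for p q
    using that rel_sym rel_trans unfolding block_def by blast
  have block_rel: "rel q r" if "q \<in> block p" "r \<in> block p" for p q r
    using that rel_sym rel_trans unfolding block_def by blast
  have integral: "?x0 q - ?x0 p \<in> \<int>" if "p \<in> {1..n}" "q \<in> block p" for p q
  proof (rule ccontr)
    \<comment> \<open>A crossing hyperplane would join \<open>U\<close> to its complement by an integral difference.\<close>
    define U where "U = {r \<in> block p. ?x0 r - ?x0 p \<in> \<int>}"
    have "rel p q" "q \<in> {1..n}" using that(2) by (simp_all add: block_def)
    assume "?x0 q - ?x0 p \<notin> \<int>"
    then have "q \<notin> U" by (simp add: U_def)
    moreover have "p \<in> U" using that rel_refl by (simp add: U_def block_def)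
    moreover have "U \<subseteq> {1..n}" by (auto simp: U_def block_def)
    ultimately obtain s t where st: "linked s t \<or> linked t s" "s \<in> U" "t \<notin> U"
      using cut[of U p q] \<open>rel p q\<close> \<open>q \<in> {1..n}\<close> by blast
    have "?x0 t - ?x0 s \<in> \<int>"
      using st(1) linkedD by (metis Ints_minus Ints_of_int minus_diff_eq)
    moreover have "?x0 s - ?x0 p \<in> \<int>" using st(2) by (simp add: U_def)
    ultimately have "(?x0 t - ?x0 s) + (?x0 s - ?x0 p) \<in> \<int>" by (rule Ints_add)
    then have "?x0 t - ?x0 p \<in> \<int>" by simp
    moreover have "t \<in> block p" using block_closed st U_def by blast
    ultimately show False using st(3) by (simp add: U_def)
  qed
  define ht where "ht B q = (if q \<in> B then \<lfloor>?x0 q - Min (?x0 ` B)\<rfloor> else 0)" for B q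
  have ht_real: "of_int (ht (block p) q) = ?x0 q - Min (?x0 ` block p)"
    if "p \<in> {1..n}" "q \<in> block p" for p q
  proof -
    have "finite (block p)" by (simp add: block_def)
    then have "Min (?x0 ` block p) \<in> ?x0 ` block p" using that(2) by (intro Min_in) auto
    then obtain b where b: "b \<in> block p" "Min (?x0 ` block p) = ?x0 b" by blast
    have "(?x0 q - ?x0 p) - (?x0 b - ?x0 p) \<in> \<int>"
      using integral[OF that] integral[OF that(1) b(1)] by (rule Ints_diff)
    then have "?x0 q - ?x0 b \<in> \<int>" by simp
    then show ?thesis using that(2) b(2) by (simp add: ht_def of_int_floor)
  qed
  have ht_diff: "of_int (ht (block p) q - ht (block p) r) = ?x0 q - ?x0 r"
    if "p \<in> {1..n}" "q \<in> block p" "r \<in> block p" for p q r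
    using ht_real[OF that(1,2)] ht_real[OF that(1,3)] by simp
  have heights: "ht (block p) \<in> heights m (block p)" if p: "p \<in> {1..n}" for p
    unfolding heights_def
  proof (intro CollectI conjI allI ballI impI)
    have fin: "finite (block p)" by (simp add: block_def)
    show "ht (block p) q = 0" if "q \<notin> block p" for q using that by (simp add: ht_def)
    show "0 \<le> ht (block p) q" if "q \<in> block p" for q
      using that fin by (simp add: ht_def)
    have "p \<in> block p" using p rel_refl by (simp add: block_def)
    then have "Min (?x0 ` block p) \<in> ?x0 ` block p" using fin by (intro Min_in) auto
    then obtain b where "b \<in> block p" "Min (?x0 ` block p) = ?x0 b" by blast
    then show "\<exists>q\<in>block p. ht (block p) q = 0" by (intro bexI[of _ b]) (simp_all add: ht_def)
    fix q r assume qr: "q \<in> block p" "r \<in> block p" "before (ht (block p)) q r"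
    let ?h = "ht (block p)"
    \<comment> \<open>The vertices before \<open>r\<close> are joined to some vertex \<open>t\<close> that is \<open>r\<close> or comes after it; shrinking that edge
      on the right gives an edge that ends in \<open>r\<close>.\<close>
    define U where "U = {s \<in> block p. before ?h s r}"
    have "r \<notin> U" "q \<in> U" "U \<subseteq> {1..n}" "r \<in> {1..n}"
      using qr before_irrefl by (auto simp: U_def block_def)
    then obtain s t where st: "linked s t \<or> linked t s" "s \<in> U" "t \<notin> U"
      using cut[of U q r] block_rel[OF qr(1,2)] by blast
    have s: "s \<in> block p" "before ?h s r" using st(2) by (simp_all add: U_def)
    have t: "t \<in> block p" using block_closed[OF st(1) s(1)] .
    then have t_after: "t = r \<or> before ?h r t"
      using st(3) before_linear[of ?h t r] by (auto simp: U_def)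
    have "reach m ?h s t \<or> reach m ?h t s"
    proof -
      have "reach m ?h i j \<or> reach m ?h j i" if "linked i j" "i \<in> block p" "j \<in> block p" for i j
      proof -
        from linkedD[OF that(1)]
        obtain a where a: "1 - int m \<le> a" "a \<le> int m" "?x0 i - ?x0 j = of_int a"
          by blast
        then have "real_of_int (?h i - ?h j) = real_of_int a"
          using ht_diff[OF p that(2,3)] by simp
        then have "?h i - ?h j = a" by (simp only: of_int_eq_iff)
        moreover have "i < j" using that(1) by (simp add: linked_def)
        ultimately show ?thesis using reach_iff_shi_bounds[of i j m ?h] a by simp
      qed
      then show ?thesis using st(1) s(1) t by blast
    qed
    moreover have "\<not> reach m ?h t s"
    proof
      assume "reach m ?h t s"
      then have "before ?h t r" using s(2) before_trans[of ?h t s r] by (simp add: reach_def)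
      then show False using st(3) t by (simp add: U_def)
    qed
    ultimately have "reach m ?h s t" by blast
    then have "reach m ?h s r"
      using t_after reach_shrink_right[of m ?h s t r] s(2) by blast
    then show "\<exists>s\<in>block p. reach m ?h s r" using s(1) by blast
  qed
  define S where "S = (\<lambda>B. (B, ht B)) ` block ` {1..n}"
  have fstS: "fst ` S = block ` {1..n}" by (simp add: S_def image_image)
  have "partition_on {1..n} (block ` {1..n})"
  proof (rule partition_onI)
    show "\<Union>(block ` {1..n}) = {1..n}" using rel_refl by (auto simp: block_def)
    show "{} \<notin> block ` {1..n}" using rel_refl by (fastforce simp: block_def)
    fix B C assume "B \<in> block ` {1..n}" "C \<in> block ` {1..n}" and ne: "B \<noteq> C"
    then obtain p q where pq: "B = block p" "C = block q" by blast
    have "r \<notin> C" if "r \<in> B" for r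
      using that ne block_eq rel_sym rel_trans unfolding pq block_def by blast
    then show "disjnt B C" by (auto simp: disjnt_def)
  qed
  moreover have "inj_on fst S" by (auto simp: S_def inj_on_def)
  moreover have "\<forall>(B, f)\<in>S. f \<in> heights m B" using heights by (auto simp: S_def)
  ultimately have dec: "S \<in> decorated_partitions (heights m) (card S) {1..n}"
    by (simp add: decorated_partitions_def fstS)
  have "X = flat_of n S"
  proof (intro equalityI subsetI)
    fix x assume x: "x \<in> X"
    have "Poly_Mapping.lookup x q - Poly_Mapping.lookup x r = of_int (f q - f r)"
      if "(B, f) \<in> S" "q \<in> B" "r \<in> B" for B f q r
    proof -
      obtain p where p: "p \<in> {1..n}" "B = block p" "f = ht (block p)"
        using \<open>(B, f) \<in> S\<close> by (auto simp: S_def)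
      have "rel q r" using block_rel that p(2) by blast
      then show ?thesis using ht_diff[OF p(1), of q r] x that p by (simp add: rel_def)
    qed
    then show "x \<in> flat_of n S" using x X by (auto simp: flat_of_def simp del: of_int_diff)
  next
    fix x assume x: "x \<in> flat_of n S"
    have "x \<in> H" if H: "H \<in> \<B>" for H
    proof -
      obtain i j a where ij: "linked i j"
        and Heq: "H = {x \<in> coord_space n. Poly_Mapping.lookup x i - Poly_Mapping.lookup x j = of_int a}"
        using hyperplane[OF H] by blast
      have i: "i \<in> {1..n}" and j: "j \<in> {1..n}" using ij by (simp_all add: linked_def)
      have mem: "i \<in> block i" "j \<in> block i" using i j rel_refl linkedD[OF ij] by (simp_all add: block_def)
      have "(block i, ht (block i)) \<in> S" using i by (simp add: S_def)
      from flat_ofD[OF x this mem] ht_diff[OF i mem]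
      have "Poly_Mapping.lookup x i - Poly_Mapping.lookup x j = ?x0 i - ?x0 j" by simp
      moreover have "x0 \<in> \<Inter>\<B>" using x0 X by simp
      from InterD[OF this H] have "?x0 i - ?x0 j = of_int a" by (simp add: Heq)
      ultimately show ?thesis using x by (simp add: Heq flat_of_def)
    qed
    then show "x \<in> X" using x X by (auto simp: flat_of_def)
  qed
  with dec show thesis by (rule that)
qed

lemma bij_betw_flat_of:
  "bij_betw (flat_of n) (decorated_partitions (heights m) k {1..n})
    (flats_of_dim k (coord_space n) (shi_arrangement m n))"
  unfolding bij_betw_def
proof (intro conjI equalityI subsetI)
  show "inj_on (flat_of n) (decorated_partitions (heights m) k {1..n})"
    by (intro inj_onI flat_of_inj)
  fix X assume "X \<in> flat_of n ` decorated_partitions (heights m) k {1..n}"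
  then show "X \<in> flats_of_dim k (coord_space n) (shi_arrangement m n)"
    using flat_of_in_flats affine_dim_flat_of by (auto simp: flats_of_dim_def)
next
  fix X assume X: "X \<in> flats_of_dim k (coord_space n) (shi_arrangement m n)"
  then obtain S where S: "S \<in> decorated_partitions (heights m) (card S) {1..n}" "X = flat_of n S"
    using flats_cases[of X n m] by (auto simp: flats_of_dim_def)
  then have "card S = k" using affine_dim_flat_of[OF S(1)] X by (simp add: flats_of_dim_def)
  then show "X \<in> flat_of n ` decorated_partitions (heights m) k {1..n}" using S by blast
qed

section \<open>The generating functions\<close>

lemma heights_egf:
  "Abs_fps (\<lambda>n. of_nat (if n = 0 then 0 else fact n * m ^ (n - 1)) / fact n)
    = (fps_X / (1 - of_nat m * fps_X) :: real fps)" (is "?C = _ / ?u")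
proof -
  have nth: "fps_nth ?C n = (if n = 0 then 0 else of_nat m ^ (n - 1))" for n by simp
  have prod: "?C * ?u = fps_X"
  proof (rule fps_ext)
    fix n
    have "?C * ?u = ?C - fps_const (of_nat m) * (fps_X * ?C)"
      by (simp add: algebra_simps fps_of_nat)
    then have "fps_nth (?C * ?u) n = fps_nth ?C n - of_nat m * fps_nth (fps_X * ?C) n"
      by (simp only: fps_sub_nth fps_mult_left_const_nth)
    also have "\<dots> = fps_nth fps_X n"
      unfolding fps_X_mult_nth nth fps_X_nth by (cases n) (simp_all add: power_eq_if)
    finally show "fps_nth (?C * ?u) n = fps_nth fps_X n" .
  qed
  have unit: "fps_nth ?u 0 \<noteq> 0" by simp
  have "fps_X / ?u = ?C * ?u * inverse ?u"
    unfolding prod by (rule fps_divide_unit[OF unit])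
  also have "\<dots> = ?C"
    by (simp only: mult.assoc inverse_mult_eq_1'[OF unit] mult_1_right)
  finally show ?thesis by (rule sym)
qed

lemma card_flats_of_dim:
  "real (card (flats_of_dim k (coord_space n) (shi_arrangement m n))) =
    fact n * fps_nth (fps_const (1 / fact k) * (fps_X / (1 - of_nat m * fps_X)) ^ k) n"
proof -
  let ?c = "\<lambda>n. if n = 0 then 0 else fact n * m ^ (n - 1)"
  have "card (flats_of_dim k (coord_space n) (shi_arrangement m n)) =
      card (decorated_partitions (heights m) k {1..n})"
    using bij_betw_same_card[OF bij_betw_flat_of] by metis
  moreover have "real (card (decorated_partitions (heights m) k {1..n})) =
      fact (card {1..n}) * fps_nth (fps_const (1 / fact k) * (fps_X / (1 - of_nat m * fps_X)) ^ k) (card {1..n})"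
  proof (rule card_decorated_partitions[where c = ?c])
    show "finite (heights m B)" if "finite B" for B
      using that card_heights(1)[of B m] by (cases "B = {}") (simp_all add: heights_empty)
    show "card (heights m B) = ?c (card B)" if "finite B" for B
      using that card_heights(2)[of B m] by (cases "B = {}") (simp_all add: heights_empty)
  qed (simp_all add: heights_egf)
  ultimately show ?thesis by simp
qed

theorem corollary1p14:
  fixes m k :: nat
  assumes "m \<ge> 1"
  shows "(Abs_fps (\<lambda>n. real (card (flats_of_dim k (coord_space n) (shi_arrangement m n))) / fact n)
           = fps_const (1 / fact k) * (fps_X / (1 - of_nat m * fps_X)) ^ k) \<and>
         (Abs_fps (\<lambda>n. real (card (flats (coord_space n) (shi_arrangement m n))) / fact n)
           = fps_exp 1 oo (fps_X / (1 - of_nat m * fps_X)))"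
proof
  show "Abs_fps (\<lambda>n. real (card (flats_of_dim k (coord_space n) (shi_arrangement m n))) / fact n)
           = fps_const (1 / fact k) * (fps_X / (1 - of_nat m * fps_X)) ^ k"
    by (rule fps_ext) (simp add: card_flats_of_dim)
  define C :: "real fps" where "C = fps_X / (1 - of_nat m * fps_X)"
  have C0: "fps_nth C 0 = 0" by (simp add: C_def heights_egf[symmetric])
  show "Abs_fps (\<lambda>n. real (card (flats (coord_space n) (shi_arrangement m n))) / fact n)
           = fps_exp 1 oo (fps_X / (1 - of_nat m * fps_X))"
    unfolding C_def[symmetric]
  proof (rule fps_ext)
    fix n
    let ?F = "\<lambda>k. flats_of_dim k (coord_space n) (shi_arrangement m n)"
    have fin: "finite (?F k)" for k
      using finite_flats[OF finite_shi_arrangement, of "coord_space n" m n]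
      by (simp add: flats_of_dim_def)
    \<comment> \<open>A power series without constant term has no term of degree \<open>n\<close> in its \<open>k\<close>-th power for \<open>k > n\<close>.\<close>
    have "?F k = {}" if "n < k" for k
    proof -
      have "fps_nth (C ^ k) n = 0"
        using startsby_zero_power_prefix[OF C0] that by blast
      then have "real (card (?F k)) = 0" by (simp add: card_flats_of_dim C_def)
      then show ?thesis using fin by simp
    qed
    then have "flats (coord_space n) (shi_arrangement m n) = (\<Union>k\<in>{0..n}. ?F k)"
      by (fastforce simp: flats_of_dim_def not_less[symmetric])
    then have "card (flats (coord_space n) (shi_arrangement m n)) = (\<Sum>k=0..n. card (?F k))"
      using fin by (simp only:) (intro card_UN_disjoint, auto simp: flats_of_dim_def)
    then have "real (card (flats (coord_space n) (shi_arrangement m n))) / fact n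
        = (\<Sum>k=0..n. fps_nth (C ^ k) n / fact k)"
      by (simp add: card_flats_of_dim C_def sum_divide_distrib)
    then show "fps_nth (Abs_fps (\<lambda>n. real (card (flats (coord_space n) (shi_arrangement m n))) / fact n)) n
        = fps_nth (fps_exp 1 oo C) n"
      by (simp add: fps_compose_nth)
  qed
qed

end
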